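(* Let $(\boldsymbol{d}_D)$ be a holomorphically contractible system and let $D\subset\mathbb{C}^m$ be a bounded domain. Assume that there exist two sequences $(I_n)_{n\in\mathbb{N}}$, $(E_n)_{n\in\mathbb{N}}$ of domains (in $\mathbb{C}^m$) such that $$E_{n+1}\subset\subset E_n\ (n\in\mathbb{N}),\quad \bigcap_{n\in\mathbb{N}}E_n=\overline{D},\quad I_n\subset\subset I_{n+1}\ (n\in\mathbb{N}),\quad \bigcup_{n\in\mathbb{N}}I_n=D,$$ and such that for all $z,w\in D$ $$\lim_{n\rightarrow\infty}\boldsymbol{d}_{E_n}(z,w)=\lim_{n\rightarrow\infty}\boldsymbol{d}_{I_n}(z,w)=\boldsymbol{d}_D(z,w).$$ Let $(D_n)_{n\in\mathbb{N}}$ be a sequence of bounded domains in $\mathbb{C}^m$ such that $$\lim_{n\rightarrow\infty}\mathfrak{H}(\overline{D}_n,\overline{D})=0$$ and such that for each compact $K\subset D$ there exists an $n_0\in\mathbb{N}$ such that $K\subset D_n$ for every $n\geq n_0$. Then for any $z,w\in D$ $$\lim_{n\rightarrow\infty}\boldsymbol{d}_{D_n}(z,w)=\boldsymbol{d}_D(z,w).$$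
   Context: A domain is a nonempty connected open subset of some $\mathbb{C}^n$. $A\subset\subset B$ means that $A$ is relatively compact in $B$, i.e. $\overline{A}$ is compact and contained in $B$. $\mathbb{D}$ is the open unit disc in $\mathbb{C}$, and $\boldsymbol{p}$ is the hyperbolic distance on $\mathbb{D}$, normalized by $\tanh\boldsymbol{p}(a,b)=\left|\frac{a-b}{1-\overline{a}b}\right|$. $\mathcal{O}(D,G)$ is the set of holomorphic mappings $D\to G$. Holomorphically contractible system: a family $(\boldsymbol{d}_D)$ of functions $\boldsymbol{d}_D:D\times D\rightarrow[0,+\infty)$, where $D$ runs over all domains in $\mathbb{C}^n$ with arbitrary $n$, such that (1) $\boldsymbol{d}_{\mathbb{D}}=\boldsymbol{p}$; (2) for any two domains $D\subset\mathbb{C}^n$, $G\subset\mathbb{C}^m$ and any $f\in\mathcal{O}(D,G)$ one has $\boldsymbol{d}_G(f(z),f(w))\leq\boldsymbol{d}_D(z,w)$ for $z,w\in D$. Hausdorff distance: for nonempty bounded sets $A,B\subset\mathbb{C}^m$, $\mathfrak{H}(A,B):=\inf\{\delta>0: A\subset B^{(\delta)}\text{ and }B\subset A^{(\delta)}\}$, where $S^{(\varepsilon)}:=\bigcup_{s\in S}\mathbb{B}(s,\varepsilon)$ and $\mathbb{B}(x,r)$ is the open Euclidean ball of center $x$ and radius $r$. The limits of $\boldsymbol{d}_{I_n}(z,w)$ and $\boldsymbol{d}_{D_n}(z,w)$ are taken over those $n$ large enough that $z,w\in I_n$, respectively $z,w\in D_n$ (which by the hypotheses holds for all sufficiently large $n$).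 *)

theory Defs
  imports "HOL-Analysis.Analysis"
begin

text \<open>
  A holomorphically contractible system involves all dimensions at once, so the dimension has
  to be a number rather than a type.  As in \<^theory>\<open>HOL-Analysis.Abstract_Euclidean_Space\<close>,
  the points of complex \<open>n\<close>-space are the sequences vanishing from index \<open>n\<close> on, and the topology
  is inherited from the product topology on \<^typ>\<open>nat \<Rightarrow> complex\<close>; on \<open>Cspace n\<close> this is the
  Euclidean topology.  Since \<open>Cspace n\<close> is closed, closures and compactness may be taken in the
  ambient type.  The overloaded \<^const>\<open>dist\<close>, \<^const>\<open>ball\<close> and \<^const>\<open>bounded\<close> on
  \<^typ>\<open>nat \<Rightarrow> complex\<close> come from a bounded metric that is not the Euclidean one, so the
  Euclidean metric notions are defined explicitly.
\<close>

definition Cspace :: "nat \<Rightarrow> (nat \<Rightarrow> complex) set" where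
  "Cspace n = {z. \<forall>i\<ge>n. z i = 0}"

definition edist :: "nat \<Rightarrow> (nat \<Rightarrow> complex) \<Rightarrow> (nat \<Rightarrow> complex) \<Rightarrow> real" where
  "edist n z w = L2_set (\<lambda>i. cmod (z i - w i)) {..<n}"

definition eball :: "nat \<Rightarrow> (nat \<Rightarrow> complex) \<Rightarrow> real \<Rightarrow> (nat \<Rightarrow> complex) set" where
  "eball n x r = {y \<in> Cspace n. edist n x y < r}"

definition ebounded :: "nat \<Rightarrow> (nat \<Rightarrow> complex) set \<Rightarrow> bool" where
  "ebounded n S \<longleftrightarrow> (\<exists>r. S \<subseteq> eball n (\<lambda>_. 0) r)"

definition domain_in :: "nat \<Rightarrow> (nat \<Rightarrow> complex) set \<Rightarrow> bool" where
  "domain_in n D \<longleftrightarrow> n \<ge> 1 \<and> D \<noteq> {} \<and> connected D \<and> openin (top_of_set (Cspace n)) D"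

definition rel_compact_in :: "'a::topological_space set \<Rightarrow> 'a set \<Rightarrow> bool"
    (infix "\<subset>\<subset>" 50) where
  "A \<subset>\<subset> B \<longleftrightarrow> compact (closure A) \<and> closure A \<subseteq> B"

text \<open>
  Complex Frechet differentiability at every point of \<open>D\<close>, a domain in \<open>Cspace n\<close>; the \<open>c j\<close> are
  the complex partial derivatives at \<open>a\<close>.
\<close>

definition holomorphic_fun :: "nat \<Rightarrow> (nat \<Rightarrow> complex) set \<Rightarrow> ((nat \<Rightarrow> complex) \<Rightarrow> complex) \<Rightarrow> bool"
  where
  "holomorphic_fun n D f \<longleftrightarrow>
     (\<forall>a\<in>D. \<exists>c :: nat \<Rightarrow> complex.
        ((\<lambda>z. (f z - f a - (\<Sum>j<n. c j * (z j - a j))) / of_real (edist n z a)) \<longlongrightarrow> 0)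
          (at a within D))"

definition holomorphic_maps ::
    "nat \<Rightarrow> (nat \<Rightarrow> complex) set \<Rightarrow> nat \<Rightarrow> (nat \<Rightarrow> complex) set \<Rightarrow> ((nat \<Rightarrow> complex) \<Rightarrow> (nat \<Rightarrow> complex)) set"
  where
  "holomorphic_maps n D m G =
     {f. f \<in> D \<rightarrow> G \<and> (\<forall>j<m. holomorphic_fun n D (\<lambda>z. f z j))}"

definition unit_disc :: "(nat \<Rightarrow> complex) set" where
  "unit_disc = {z \<in> Cspace 1. cmod (z 0) < 1}"

definition hyp_dist :: "complex \<Rightarrow> complex \<Rightarrow> real" where
  "hyp_dist a b = artanh (cmod ((a - b) / (1 - cnj a * b)))"

text \<open>
  A nonempty relatively open subset of \<open>Cspace n\<close> determines \<open>n\<close>, so the family is indexed by the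
  domain alone.  Values of \<open>d D\<close> outside \<open>D \<times> D\<close>, or for \<open>D\<close> not a domain, are irrelevant.
\<close>

definition hol_contractible_system ::
    "((nat \<Rightarrow> complex) set \<Rightarrow> (nat \<Rightarrow> complex) \<Rightarrow> (nat \<Rightarrow> complex) \<Rightarrow> real) \<Rightarrow> bool"
  where
  "hol_contractible_system d \<longleftrightarrow>
     (\<forall>n D. domain_in n D \<longrightarrow> (\<forall>z\<in>D. \<forall>w\<in>D. 0 \<le> d D z w)) \<and>
     (\<forall>z\<in>unit_disc. \<forall>w\<in>unit_disc. d unit_disc z w = hyp_dist (z 0) (w 0)) \<and>
     (\<forall>n D m G f. domain_in n D \<longrightarrow> domain_in m G \<longrightarrow> f \<in> holomorphic_maps n D m G \<longrightarrow>
        (\<forall>z\<in>D. \<forall>w\<in>D. d G (f z) (f w) \<le> d D z w))"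

definition eneighbourhood :: "nat \<Rightarrow> (nat \<Rightarrow> complex) set \<Rightarrow> real \<Rightarrow> (nat \<Rightarrow> complex) set" where
  "eneighbourhood n S r = (\<Union>s\<in>S. eball n s r)"

definition hausdorff_dist :: "nat \<Rightarrow> (nat \<Rightarrow> complex) set \<Rightarrow> (nat \<Rightarrow> complex) set \<Rightarrow> real" where
  "hausdorff_dist n A B =
     Inf {\<delta>. \<delta> > 0 \<and> A \<subseteq> eneighbourhood n B \<delta> \<and> B \<subseteq> eneighbourhood n A \<delta>}"

end

theory Submission
  imports Defs
begin

text \<open>
  The sandwich \<open>I k \<subseteq> Dn n \<subseteq> E k\<close> proves the theorem.  Inclusions between domains are
  holomorphic, so a holomorphically contractible system decreases when the domain grows: once the
  sandwich holds, \<open>d (E k) z w \<le> d (Dn n) z w \<le> d (I k) z w\<close>.  Both outer terms are close to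
  \<open>d D z w\<close> for a suitable fixed \<open>k\<close>, so it remains to establish the sandwich for fixed \<open>k\<close> and all
  large \<open>n\<close>.

  The inner inclusion is the hypothesis on compact subsets of \<open>D\<close>, applied to the closure of
  \<open>I k\<close>.  For the outer one, the closure of \<open>D\<close> is a compact subset of the open set \<open>E k\<close>, so
  \<open>E k\<close> contains a whole Euclidean \<open>\<epsilon>\<close>-neighbourhood of it (lemma
  \<open>compact_eneighbourhood_subset\<close>), and Hausdorff convergence puts \<open>Dn n\<close> into that neighbourhood
  (lemma \<open>hausdorff_dist_less_imp_subset\<close>).
\<close>

lemma edist_commute: "edist n z w = edist n w z"
  by (simp add: edist_def norm_minus_commute)

lemma edist_triangle: "edist n x z \<le> edist n x y + edist n y z"
proof -
  have "cmod (x i - z i) \<le> cmod (x i - y i) + cmod (y i - z i)" for i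
    using norm_triangle_ineq[of "x i - y i" "y i - z i"] by simp
  then have "edist n x z \<le> L2_set (\<lambda>i. cmod (x i - y i) + cmod (y i - z i)) {..<n}"
    unfolding edist_def
    by (intro L2_set_mono) auto
  also have "\<dots> \<le> edist n x y + edist n y z"
    unfolding edist_def by (rule L2_set_triangle_ineq)
  finally show ?thesis .
qed

lemma cmod_diff_le_edist:
  assumes "i < n"
  shows "cmod (z i - w i) \<le> edist n z w"
  unfolding edist_def using assms by (intro member_le_L2_set) auto

lemma closed_Cspace: "closed (Cspace n)"
proof -
  have "closed (\<Inter>i\<in>{n..}. {z :: nat \<Rightarrow> complex. z i = 0})"
    by (intro closed_INT ballI closed_Collect_eq continuous_intros) auto
  also have "(\<Inter>i\<in>{n..}. {z :: nat \<Rightarrow> complex. z i = 0}) = Cspace n"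
    by (auto simp: Cspace_def)
  finally show ?thesis .
qed

lemma closed_ecball: "closed {z. edist n a z \<le> r}"
  unfolding edist_def L2_set_def
  by (intro closed_Collect_le continuous_intros) auto

text \<open>
  The infimum defining the Hausdorff distance of two nonempty bounded sets is over a nonempty set:
  any number exceeding the sum of the radii of two balls around the origin that contain them is an
  admissible \<open>\<delta>\<close>.  So an infimum below \<open>e\<close> comes from an admissible \<open>\<delta>\<close> below \<open>e\<close>, whereas
  the infimum of the empty set of reals carries no such information.
\<close>

lemma hausdorff_dist_less_imp_subset:
  assumes bdd: "ebounded n A" "ebounded n B" and ne: "A \<noteq> {}" "B \<noteq> {}"
    and less: "hausdorff_dist n (closure A) (closure B) < e"
  shows "A \<subseteq> eneighbourhood n (closure B) e"
proof -
  let ?A = "closure A" and ?B = "closure B"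
  let ?S = "{\<delta>. \<delta> > 0 \<and> ?A \<subseteq> eneighbourhood n ?B \<delta> \<and> ?B \<subseteq> eneighbourhood n ?A \<delta>}"
  have cl: "\<exists>r. closure S \<subseteq> Cspace n \<inter> {z. edist n (\<lambda>_. 0) z \<le> r}" if S: "ebounded n S" for S
  proof -
    from S obtain r where "S \<subseteq> eball n (\<lambda>_. 0) r" by (auto simp: ebounded_def)
    then have "S \<subseteq> Cspace n \<inter> {z. edist n (\<lambda>_. 0) z \<le> r}" by (auto simp: eball_def)
    then have "closure S \<subseteq> Cspace n \<inter> {z. edist n (\<lambda>_. 0) z \<le> r}"
      by (rule closure_minimal) (intro closed_Int closed_Cspace closed_ecball)
    then show ?thesis by blast
  qed
  from cl[OF bdd(1)] obtain r where r: "?A \<subseteq> Cspace n \<inter> {z. edist n (\<lambda>_. 0) z \<le> r}" by blast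
  from cl[OF bdd(2)] obtain s where s: "?B \<subseteq> Cspace n \<inter> {z. edist n (\<lambda>_. 0) z \<le> s}" by blast
  define t where "t = max 0 (r + s) + 1"
  have t: "edist n a b < t \<and> edist n b a < t" if "a \<in> ?A" "b \<in> ?B" for a b
  proof -
    have "edist n a b \<le> edist n a (\<lambda>_. 0) + edist n (\<lambda>_. 0) b" by (rule edist_triangle)
    also have "\<dots> \<le> r + s"
      using r s that by (intro add_mono) (auto simp: edist_commute[of n a])
    finally show ?thesis by (auto simp: t_def edist_commute[of n b])
  qed
  obtain a b where ab: "a \<in> ?A" "b \<in> ?B" using ne by (metis closure_eq_empty ex_in_conv)
  have "x \<in> eneighbourhood n ?B t" if "x \<in> ?A" for x
    using t[OF that ab(2)] ab(2) r that by (auto simp: eneighbourhood_def eball_def)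
  moreover have "x \<in> eneighbourhood n ?A t" if "x \<in> ?B" for x
    using t[OF ab(1) that] ab(1) s that by (auto simp: eneighbourhood_def eball_def)
  ultimately have "t \<in> ?S" by (auto simp: t_def)
  then have "?S \<noteq> {}" by blast
  with less obtain \<delta> where "\<delta> \<in> ?S" "\<delta> < e"
    unfolding hausdorff_dist_def by (meson cInf_lessD)
  then have "A \<subseteq> eneighbourhood n ?B \<delta>" using closure_subset[of A] by blast
  also have "\<dots> \<subseteq> eneighbourhood n ?B e"
    unfolding eneighbourhood_def using \<open>\<delta> < e\<close> by (intro UN_mono) (auto simp: eball_def)
  finally show ?thesis .
qed

lemma tendsto_coordinatewise_iff:
  fixes f :: "'a \<Rightarrow> 'i \<Rightarrow> 'b::topological_space"
  shows "(f \<longlongrightarrow> l) F \<longleftrightarrow> (\<forall>i. ((\<lambda>a. f a i) \<longlongrightarrow> l i) F)"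
  using limitin_componentwise[of "\<lambda>_::'i. euclidean :: 'b topology" UNIV f l F]
  by (simp add: euclidean_product_topology)

text \<open>
  Euclidean convergence is coordinatewise, hence implies convergence in the product topology.  If
  no \<open>\<epsilon>\<close> worked, points outside \<open>U\<close> whose Euclidean distance to \<open>K\<close> tends to zero would therefore
  accumulate at a point of \<open>K \<subseteq> U\<close>.
\<close>

lemma compact_eneighbourhood_subset:
  assumes K: "compact K" "K \<subseteq> U" and U: "openin (top_of_set (Cspace n)) U"
  shows "\<exists>e>0. eneighbourhood n K e \<subseteq> U"
proof (rule ccontr)
  assume neg: "\<not> ?thesis"
  have "\<exists>x y. x \<in> K \<and> y \<in> Cspace n \<and> y \<notin> U \<and> edist n x y < 1 / Suc k" for k :: nat
  proof -
    have "1 / real (Suc k) > 0" by simp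
    with neg have "\<not> eneighbourhood n K (1 / Suc k) \<subseteq> U" by blast
    then show ?thesis by (auto simp: eneighbourhood_def eball_def)
  qed
  then obtain x y where xy: "\<And>k. x k \<in> K" "\<And>k. y k \<in> Cspace n" "\<And>k. y k \<notin> U"
    "\<And>k. edist n (x k) (y k) < 1 / Suc k" by metis
  obtain T where T: "open T" "U = Cspace n \<inter> T" using U unfolding openin_open by blast
  have "seq_compact K" using K(1) by (rule compact_imp_seq_compact)
  with xy(1) obtain l \<rho> where l: "l \<in> K" "strict_mono \<rho>" "(x \<circ> \<rho>) \<longlonglongrightarrow> l"
    by (meson seq_compactE)
  have lim: "(\<lambda>k. x (\<rho> k) i) \<longlonglongrightarrow> l i" for i
    using l(3) by (simp add: tendsto_coordinatewise_iff o_def)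
  have "(\<lambda>k. y (\<rho> k) i) \<longlonglongrightarrow> l i" for i
  proof (cases "i < n")
    case True
    have "(\<lambda>k. y k i - x k i) \<longlonglongrightarrow> 0"
    proof (rule Lim_null_comparison)
      have "norm (y k i - x k i) \<le> 1 / Suc k" for k
        using cmod_diff_le_edist[OF True, of "x k" "y k"] xy(4)[of k]
        by (simp add: norm_minus_commute)
      then show "\<forall>\<^sub>F k in sequentially. norm (y k i - x k i) \<le> 1 / Suc k"
        by (rule always_eventually[OF allI])
      show "(\<lambda>k. 1 / real (Suc k)) \<longlonglongrightarrow> 0" by (rule LIMSEQ_Suc[OF lim_1_over_n])
    qed
    from tendsto_add[OF LIMSEQ_subseq_LIMSEQ[OF this l(2)] lim[of i]]
    show ?thesis by (simp add: o_def)
  next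
    case False
    have "x k \<in> Cspace n" "y k \<in> Cspace n" for k
      using xy(1,2)[of k] K(2) T(2) by auto
    with False have "x k i = 0" "y k i = 0" for k
      by (simp_all add: Cspace_def)
    then show ?thesis using lim[of i] by simp
  qed
  then have "(\<lambda>k. y (\<rho> k)) \<longlonglongrightarrow> l" by (simp add: tendsto_coordinatewise_iff)
  then have "\<forall>\<^sub>F k in sequentially. y (\<rho> k) \<in> T"
    using T K(2) l(1) by (intro topological_tendstoD) auto
  then obtain k where "y (\<rho> k) \<in> T" using eventually_happens'[OF sequentially_bot] by blast
  then show False using xy(2,3) T(2) by blast
qed

lemma id_holomorphic_maps:
  assumes "D \<subseteq> G"
  shows "(\<lambda>z. z) \<in> holomorphic_maps n D n G"
proof -
  have "holomorphic_fun n D (\<lambda>z. z j)" if "j < n" for j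
    unfolding holomorphic_fun_def
  proof (intro ballI exI)
    fix a
    have "(\<Sum>i<n. (if i = j then 1 else 0) * (z i - a i)) = z j - a j" for z :: "nat \<Rightarrow> complex"
      using that by (simp add: if_distrib[of "\<lambda>u. u * _"] sum.delta cong: if_cong)
    then show "((\<lambda>z. (z j - a j - (\<Sum>i<n. (if i = j then 1 else 0) * (z i - a i)))
        / of_real (edist n z a)) \<longlongrightarrow> 0) (at a within D)"
      by simp
  qed
  with assms show ?thesis by (auto simp: holomorphic_maps_def)
qed

lemma hol_contractible_system_antimono:
  assumes "hol_contractible_system d" "domain_in n D" "domain_in n G" "D \<subseteq> G" "z \<in> D" "w \<in> D"
  shows "d G z w \<le> d D z w"
  using assms id_holomorphic_maps[OF assms(4), of n] unfolding hol_contractible_system_def by blast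

theorem theorem1p1:
  fixes d :: "(nat \<Rightarrow> complex) set \<Rightarrow> (nat \<Rightarrow> complex) \<Rightarrow> (nat \<Rightarrow> complex) \<Rightarrow> real"
    and m :: nat
    and D :: "(nat \<Rightarrow> complex) set"
    and I E Dn :: "nat \<Rightarrow> (nat \<Rightarrow> complex) set"
  assumes "hol_contractible_system d"
    and "domain_in m D" and "ebounded m D"
    and "\<And>n. domain_in m (I n)" and "\<And>n. domain_in m (E n)"
    and "\<And>n. E (Suc n) \<subset>\<subset> E n" and "(\<Inter>n. E n) = closure D"
    and "\<And>n. I n \<subset>\<subset> I (Suc n)" and "(\<Union>n. I n) = D"
    and "\<And>z w. z \<in> D \<Longrightarrow> w \<in> D \<Longrightarrow> (\<lambda>n. d (E n) z w) \<longlonglongrightarrow> d D z w"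
    and "\<And>z w. z \<in> D \<Longrightarrow> w \<in> D \<Longrightarrow> (\<lambda>n. d (I n) z w) \<longlonglongrightarrow> d D z w"
    and "\<And>n. domain_in m (Dn n)" and "\<And>n. ebounded m (Dn n)"
    and "(\<lambda>n. hausdorff_dist m (closure (Dn n)) (closure D)) \<longlonglongrightarrow> 0"
    and "\<And>K. compact K \<Longrightarrow> K \<subseteq> D \<Longrightarrow> \<exists>n0. \<forall>n\<ge>n0. K \<subseteq> Dn n"
  shows "\<forall>z\<in>D. \<forall>w\<in>D. (\<lambda>n. d (Dn n) z w) \<longlonglongrightarrow> d D z w"
proof (intro ballI)
  note d = assms(1) and D = assms(2,3) and I = assms(4,8,9) and E = assms(5-7)
    and Dn = assms(12,13)
  fix z w assume zw: "z \<in> D" "w \<in> D"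
  have outer: "\<forall>\<^sub>F n in sequentially. Dn n \<subseteq> E k" for k
  proof -
    have "closure D \<subseteq> closure (E (Suc k))"
      using E(3) closure_subset[of D] by (intro closure_mono) blast
    moreover have EE: "compact (closure (E (Suc k)))" "closure (E (Suc k)) \<subseteq> E k"
      using E(2)[of k] by (auto simp: rel_compact_in_def)
    ultimately have "compact (closure D)" "closure D \<subseteq> E k"
      using compact_Int_closed[OF EE(1) closed_closure, of D] by (auto simp: Int_absorb1)
    then obtain e where e: "e > 0" "eneighbourhood m (closure D) e \<subseteq> E k"
      using compact_eneighbourhood_subset[of "closure D" "E k" m] E(1)[of k]
      by (auto simp: domain_in_def)
    have "\<forall>\<^sub>F n in sequentially. hausdorff_dist m (closure (Dn n)) (closure D) < e"
      using assms(14) e(1) by (rule order_tendstoD)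
    then show ?thesis
    proof eventually_elim
      case (elim n)
      have "Dn n \<subseteq> eneighbourhood m (closure D) e"
        using elim D Dn[of n]
        by (intro hausdorff_dist_less_imp_subset) (auto simp: domain_in_def)
      then show ?case using e(2) by blast
    qed
  qed
  have inner: "\<forall>\<^sub>F n in sequentially. I k \<subseteq> Dn n" for k
  proof -
    have "compact (closure (I k))" "closure (I k) \<subseteq> D"
      using I(2)[of k] I(3) by (auto simp: rel_compact_in_def)
    from assms(15)[OF this] show ?thesis
      unfolding eventually_sequentially using closure_subset[of "I k"] by blast
  qed
  have "I k \<subseteq> I (Suc k)" for k
    using I(2)[of k] closure_subset[of "I k"] by (auto simp: rel_compact_in_def)
  then have "incseq I" by (rule incseq_SucI)
  obtain k1 k2 where k12: "z \<in> I k1" "w \<in> I k2" using zw I(3) by blast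
  have inI: "z \<in> I k \<and> w \<in> I k" if "k \<ge> max k1 k2" for k
    using k12 that incseqD[OF \<open>incseq I\<close>, of k1 k] incseqD[OF \<open>incseq I\<close>, of k2 k] by auto
  show "(\<lambda>n. d (Dn n) z w) \<longlonglongrightarrow> d D z w"
  proof (rule order_tendstoI)
    fix a assume "a < d D z w"
    with assms(10)[OF zw] obtain k where k: "a < d (E k) z w"
      using eventually_happens'[OF sequentially_bot order_tendstoD(1)] by blast
    from outer[of k] inner[of "max k1 k2"] show "\<forall>\<^sub>F n in sequentially. a < d (Dn n) z w"
    proof eventually_elim
      case (elim n)
      then have "d (E k) z w \<le> d (Dn n) z w"
        using inI[of "max k1 k2"]
        by (intro hol_contractible_system_antimono[OF d Dn(1) E(1)]) auto
      with k show ?case by simp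
    qed
  next
    fix a assume "d D z w < a"
    with assms(11)[OF zw] have "\<forall>\<^sub>F k in sequentially. d (I k) z w < a"
      by (rule order_tendstoD)
    then have "\<forall>\<^sub>F k in sequentially. d (I k) z w < a \<and> k \<ge> max k1 k2"
      by (intro eventually_conj eventually_ge_at_top)
    then obtain k where k: "d (I k) z w < a" "k \<ge> max k1 k2"
      using eventually_happens'[OF sequentially_bot] by blast
    from inner[of k] show "\<forall>\<^sub>F n in sequentially. d (Dn n) z w < a"
    proof eventually_elim
      case (elim n)
      then have "d (Dn n) z w \<le> d (I k) z w"
        using inI[OF k(2)] by (intro hol_contractible_system_antimono[OF d I(1) Dn(1)]) auto
      with k show ?case by simp
    qed
  qed
qed

end
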